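(* For every integer $n \geq 2$, \[w_{2n+1,8}^{+}=w_{2n+1,8}^{-}=\frac{2^{6n-2n-7}(2^{2n+3}-8)}{3}\] and \[w_{2n,8}=28 \times 8^{n-2}+\frac{2^{4n-5}-2^{3n-3}+2^{6n-6}-2^{3n}}{3}.\]
   Context: For $a_1,\ldots,a_n\in\mathbb{Z}/8\mathbb{Z}$, $M_{n}(a_1,\ldots,a_n):=\begin{pmatrix} a_{n} & -1 \\ 1 & 0\end{pmatrix}\cdots\begin{pmatrix} a_{1} & -1 \\ 1 & 0\end{pmatrix}$. Let $w_{n,8}^{+}$ (resp. $w_{n,8}^{-}$) be the number of $(a_1,\ldots,a_n)\in(\mathbb{Z}/8\mathbb{Z})^n$ with $M_n(a_1,\ldots,a_n)=Id$ (resp. $=-Id$), and $w_{n,8}:=w_{n,8}^{+}+w_{n,8}^{-}$. *)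

theory Defs
  imports "HOL-Analysis.Analysis"
begin

text \<open>
  The ring of integers modulo 8 is the numeral type \<open>8\<close>, whose \<open>comm_ring_1\<close>
  operations are arithmetic modulo 8. The tuple $(a_1,\ldots,a_n)$ is the list
  \<open>[a\<^sub>1, \<dots>, a\<^sub>n]\<close>.
\<close>

definition elem_mat :: "'a::comm_ring_1 \<Rightarrow> 'a^2^2" where
  "elem_mat a = vector [vector [a, -1], vector [1, 0]]"

text \<open>The factor of the first entry is the rightmost one.\<close>

primrec cont_mat :: "'a::comm_ring_1 list \<Rightarrow> 'a^2^2" where
  "cont_mat [] = mat 1"
| "cont_mat (a # as) = cont_mat as ** elem_mat a"

definition w8_plus :: "nat \<Rightarrow> nat" where
  "w8_plus n = card {as :: 8 list. length as = n \<and> cont_mat as = mat 1}"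

definition w8_minus :: "nat \<Rightarrow> nat" where
  "w8_minus n = card {as :: 8 list. length as = n \<and> cont_mat as = - mat 1}"

definition w8 :: "nat \<Rightarrow> nat" where
  "w8 n = w8_plus n + w8_minus n"

end

theory Submission
  imports Defs
begin

text \<open>
  Since \<open>M\<^sub>n\<close> has determinant 1, it equals \<open>\<plusminus>1\<close> for exactly one choice of \<open>a\<^sub>1\<close> whenever the
  product of the other factors maps \<open>(1, 0)\<close> to \<open>(0, \<minusplus>1)\<close>, and for no choice otherwise. So one
  counts walks with steps \<open>(x, y) \<mapsto> (a x - y, x)\<close> on unimodular pairs. For walks of odd length
  ending in \<open>(0, \<plusminus>1)\<close> the count depends only on whether the initial \<open>x\<close> is \<open>\<plusminus>1\<close>, \<open>\<plusminus>3\<close> or even,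
  which leaves a linear recursion in three unknowns. Replacing every \<open>a\<^sub>i\<close> by \<open>-a\<^sub>i\<close> conjugates
  \<open>M\<^sub>n\<close> by a diagonal matrix and multiplies it by \<open>(-1)\<^sup>n\<close>, so both signs are equally frequent
  for odd \<open>n\<close>.
\<close>

section \<open>Reduction of the matrix equation to walks on pairs\<close>

fun walk :: "'a::comm_ring_1 list \<Rightarrow> 'a \<times> 'a \<Rightarrow> 'a \<times> 'a" where
  "walk [] (x, y) = (x, y)"
| "walk (a # as) (x, y) = walk as (a * x - y, x)"

lemma walk_eq_cont_mat:
  "walk as (x, y) = (cont_mat as $ 1 $ 1 * x + cont_mat as $ 1 $ 2 * y,
                     cont_mat as $ 2 $ 1 * x + cont_mat as $ 2 $ 2 * y)"
proof (induction as arbitrary: x y)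
  case Nil
  show ?case by (simp add: mat_def)
next
  case (Cons a as)
  show ?case
    by (simp add: Cons.IH elem_mat_def matrix_matrix_mult_def sum_2 algebra_simps)
qed

lemma det_cont_mat: "det (cont_mat as) = 1"
  by (induction as) (simp_all add: det_mul, simp add: elem_mat_def det_2)

text \<open>With p, q in the first and r, s in the second row of \<open>cont_mat as\<close>,
  appending the factor of \<open>a\<close> gives rows (pa + q, -p) and (ra + s, -r). The right
  column forces p = 0 and r = -e; then q = e comes for free from the determinant, and ra + s = 0
  fixes \<open>a\<close>.\<close>

lemma cont_mat_Cons_eq_scalar_iff:
  fixes e :: "'a::comm_ring_1"
  assumes "e * e = 1"
  shows "cont_mat (a # as) = mat e \<longleftrightarrow>
    walk as (1, 0) = (0, - e) \<and> a = e * cont_mat as $ 2 $ 2"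
proof -
  define p q r s where "p = cont_mat as $ 1 $ 1" and "q = cont_mat as $ 1 $ 2"
    and "r = cont_mat as $ 2 $ 1" and "s = cont_mat as $ 2 $ 2"
  have det: "p * s - q * r = 1"
    using det_cont_mat[of as] by (simp add: det_2 p_def q_def r_def s_def)
  have "cont_mat (a # as) = mat e \<longleftrightarrow> p * a + q = e \<and> p = 0 \<and> r * a + s = 0 \<and> r = - e"
    by (auto simp: vec_eq_iff forall_2 matrix_matrix_mult_def sum_2 elem_mat_def mat_def
        p_def q_def r_def s_def minus_equation_iff[of _ e])
  also have "\<dots> \<longleftrightarrow> p = 0 \<and> r = - e \<and> a = e * s"
  proof -
    have "a = e * s" if "r = - e" "r * a + s = 0"
    proof -
      have "e * (e * a) = e * s" using that by (simp add: algebra_simps)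
      then show ?thesis using assms by (simp flip: mult.assoc)
    qed
    moreover have "q = e" if "p = 0" "r = - e"
    proof -
      have "q * e * e = e" using det that by simp
      then show ?thesis using assms by (simp add: mult.assoc)
    qed
    moreover have "r * a + s = 0" if "r = - e" "a = e * s"
      using that assms by (simp flip: mult.assoc)
    ultimately show ?thesis by auto
  qed
  finally show ?thesis
    by (auto simp: walk_eq_cont_mat p_def r_def s_def)
qed

definition num_walks :: "nat \<Rightarrow> 'a::comm_ring_1 \<times> 'a \<Rightarrow> 'a \<times> 'a \<Rightarrow> nat" where
  "num_walks k v t = card {as. length as = k \<and> walk as v = t}"

lemma num_walks_0: "num_walks 0 v t = of_bool (v = t)"
proof -
  have "walk [] v = v" by (cases v) simp
  then have "{as. length as = 0 \<and> walk as v = t} = (if v = t then {[]} else {})" by auto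
  then show ?thesis by (simp add: num_walks_def)
qed

lemma finite_lists_length: "finite {as :: 'a::finite list. length as = k \<and> P as}"
  by (rule finite_subset[OF _ finite_lists_length_eq[of UNIV k]]) auto

lemma num_walks_Suc:
  fixes x y :: "'a::{comm_ring_1,finite}"
  shows "num_walks (Suc k) (x, y) t = (\<Sum>a\<in>UNIV. num_walks k (a * x - y, x) t)"
proof -
  have "{as. length as = Suc k \<and> walk as (x, y) = t}
      = (\<Union>a\<in>UNIV. Cons a ` {as. length as = k \<and> walk as (a * x - y, x) = t})"
    by (fastforce simp: length_Suc_conv)
  then have "num_walks (Suc k) (x, y) t =
      (\<Sum>a\<in>UNIV. card (Cons a ` {as. length as = k \<and> walk as (a * x - y, x) = t}))"
    unfolding num_walks_def
    by (simp only:) (rule card_UN_disjoint, auto simp: finite_lists_length)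
  then show ?thesis by (simp add: card_image num_walks_def)
qed

lemma card_cont_mat_eq_scalar:
  fixes e :: "'a::{comm_ring_1,finite}"
  assumes "e * e = 1"
  shows "card {as. length as = Suc k \<and> cont_mat as = mat e} = num_walks k (1, 0) (0, - e)"
proof -
  \<comment> \<open>The first entry is a function of the others, so one step is lost and nothing
    else.\<close>
  have "{as. length as = Suc k \<and> cont_mat as = mat e}
      = (\<lambda>as. e * cont_mat as $ 2 $ 2 # as) ` {as. length as = k \<and> walk as (1, 0) = (0, - e)}"
    using cont_mat_Cons_eq_scalar_iff[OF assms]
    by (auto simp: length_Suc_conv simp del: cont_mat.simps)
  then show ?thesis
    by (simp add: card_image inj_on_def num_walks_def)
qed

text \<open>The targets belong to -Id and Id in this order. Only the sum is tracked; for odd length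
  the sign symmetry splits it in halves.\<close>

definition num_walks_pm :: "nat \<Rightarrow> 'a::comm_ring_1 \<Rightarrow> 'a \<Rightarrow> nat" where
  "num_walks_pm k x y = num_walks k (x, y) (0, 1) + num_walks k (x, y) (0, - 1)"

lemma num_walks_pm_Suc:
  fixes x y :: "'a::{comm_ring_1,finite}"
  shows "num_walks_pm (Suc k) x y = (\<Sum>a\<in>UNIV. num_walks_pm k (a * x - y) x)"
  by (simp add: num_walks_pm_def num_walks_Suc sum.distrib)

lemma mat_minus_one: "mat (- 1) = - (mat 1 :: 'a::comm_ring_1^'n^'n)"
  by (simp add: vec_eq_iff mat_def)

lemma w8_Suc: "w8 (Suc k) = num_walks_pm k (1 :: 8) 0"
  using card_cont_mat_eq_scalar[where e = "1 :: 8" and k = k]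
    card_cont_mat_eq_scalar[where e = "- 1 :: 8" and k = k]
  by (simp add: w8_def w8_plus_def w8_minus_def num_walks_pm_def mat_minus_one add.commute)

section \<open>Sign symmetry in odd length\<close>

lemma cont_mat_map_uminus:
  "cont_mat (map uminus as) $ i $ j
     = (if i = j then 1 else - 1) * (- 1) ^ length as * cont_mat as $ i $ j"
proof (induction as arbitrary: i j)
  case Nil
  show ?case by (simp add: mat_def)
next
  case (Cons a as)
  \<comment> \<open>If E is the factor of \<open>a\<close> and D = diag(1, -1), then the factor of
    \<open>- a\<close> is -DED.\<close>
  show ?case
    using exhaust_2[of i] exhaust_2[of j]
    by (auto simp: Cons.IH elem_mat_def matrix_matrix_mult_def sum_2 algebra_simps)
qed

lemma w8_plus_eq_w8_minus:
  assumes "odd n"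
  shows "w8_plus n = w8_minus n"
proof -
  \<comment> \<open>The off-diagonal entries must vanish on both sides, so only the diagonal factor
    -1 matters.\<close>
  have flip: "cont_mat (map uminus as) = - mat 1 \<longleftrightarrow> cont_mat as = mat 1"
    if "odd (length as)" for as :: "8 list"
    using that
    by (auto simp: vec_eq_iff forall_2 cont_mat_map_uminus mat_def)
  have "{as :: 8 list. length as = n \<and> cont_mat as = - mat 1}
      = map uminus ` {as. length as = n \<and> cont_mat as = mat 1}"
  proof (intro set_eqI iffI)
    fix as :: "8 list"
    assume as: "as \<in> {as. length as = n \<and> cont_mat as = - mat 1}"
    then have "map uminus as \<in> {as. length as = n \<and> cont_mat as = mat 1}"
      using flip[of "map uminus as"] assms by (simp add: comp_def)
    then show "as \<in> map uminus ` {as. length as = n \<and> cont_mat as = mat 1}"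
      by (rule rev_image_eqI) (simp add: comp_def)
  qed (use flip assms in auto)
  then show ?thesis
    by (simp add: w8_plus_def w8_minus_def card_image inj_on_def inj_map_eq_map)
qed

section \<open>Walk counts modulo 8\<close>

lemma UNIV_8: "(UNIV :: 8 set) = {0, 1, 2, 3, 4, 5, 6, 7}"
proof -
  have "card {0, 1, 2, 3, 4, 5, 6, 7 :: 8} = CARD(8)" by simp
  then show ?thesis by (metis card_subset_eq finite subset_UNIV)
qed

lemma all_8: "(\<forall>x :: 8. P x) \<longleftrightarrow> P 0 \<and> P 1 \<and> P 2 \<and> P 3 \<and> P 4 \<and> P 5 \<and> P 6 \<and> P 7"
  unfolding ball_UNIV[symmetric] UNIV_8 by simp

lemma sum_8: "(\<Sum>x\<in>(UNIV :: 8 set). f x) = f 0 + f 1 + f 2 + f 3 + f 4 + f 5 + f 6 + f 7"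
  for f :: "8 \<Rightarrow> nat"
  unfolding UNIV_8 by simp

definition odd8 :: "8 \<Rightarrow> bool" where
  "odd8 x \<longleftrightarrow> x = 1 \<or> x = 3 \<or> x = 5 \<or> x = 7"

text \<open>Numbers of walks from a unimodular pair \<open>(x, y)\<close> to \<open>(0, \<plusminus>1)\<close> in an odd,
  respectively even, number of steps; pairs with both entries even are not covered.\<close>

definition odd_profile :: "nat \<Rightarrow> nat \<Rightarrow> nat \<Rightarrow> 8 \<Rightarrow> nat" where
  "odd_profile A B C x = (if x = 1 \<or> x = 7 then A else if x = 3 \<or> x = 5 then B else C)"

definition even_profile :: "nat \<Rightarrow> nat \<Rightarrow> nat \<Rightarrow> 8 \<Rightarrow> 8 \<Rightarrow> nat" where
  "even_profile A B C x y =
    (if odd8 x then 2 * A + 2 * B + 4 * C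
     else if x = 0 then (if y = 1 \<or> y = 7 then 8 * A else 8 * B)
     else 4 * (A + B))"

text \<open>For odd \<open>x\<close> the values \<open>a * x - y\<close> run once through all
  residues. For even \<open>x\<close> they are all odd: constantly \<open>- y\<close> if
  \<open>x = 0\<close>, and otherwise split evenly between the classes {1, 7} and {3, 5}.\<close>

lemma sum_odd_profile:
  "\<forall>x y. odd8 x \<or> odd8 y \<longrightarrow> (\<Sum>a\<in>UNIV. odd_profile A B C (a * x - y)) = even_profile A B C x y"
  unfolding all_8 sum_8 by (simp add: odd_profile_def even_profile_def odd8_def)

text \<open>For odd \<open>x\<close> the new first entry is odd four times, 0 once, and 2, 4 or 6
  once each; the single 0 is what separates A from B. For even \<open>x\<close> it is always
  odd.\<close>

lemma sum_even_profile:
  "\<forall>x y. odd8 x \<or> odd8 y \<longrightarrow> (\<Sum>a\<in>UNIV. even_profile A B C (a * x - y) x)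
     = odd_profile (28 * A + 20 * B + 16 * C) (20 * A + 28 * B + 16 * C) (16 * A + 16 * B + 32 * C) x"
  unfolding all_8 sum_8 by (simp add: odd_profile_def even_profile_def odd8_def)

lemma odd8_step:
  assumes "odd8 x \<or> odd8 y"
  shows "odd8 (a * x - y) \<or> odd8 x"
proof -
  \<comment> \<open>Multiplication by 4 reads off parity and turns it into ring arithmetic.\<close>
  have odd8_iff: "\<forall>z. odd8 z \<longleftrightarrow> 4 * z = 4" and even8_iff: "\<forall>z. \<not> odd8 z \<longleftrightarrow> 4 * z = 0"
    unfolding all_8 by (simp_all add: odd8_def)
  show ?thesis
  proof (cases "odd8 x")
    case False
    then have "4 * x = 0" "4 * y = 4" using assms odd8_iff even8_iff by blast+
    then have "4 * (a * x - y) = a * 0 - 4" by (simp add: algebra_simps)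
    then show ?thesis by (simp add: odd8_iff)
  qed simp
qed

lemma num_walks_pm_odd_to_even:
  assumes "\<And>x y. odd8 x \<or> odd8 y \<Longrightarrow> num_walks_pm k x y = odd_profile A B C x"
    and "odd8 x \<or> odd8 y"
  shows "num_walks_pm (Suc k) x y = even_profile A B C x y"
proof -
  have "num_walks_pm k (a * x - y) x = odd_profile A B C (a * x - y)" for a
    using assms odd8_step by blast
  then show ?thesis
    using sum_odd_profile assms(2) by (simp only: num_walks_pm_Suc)
qed

lemma num_walks_pm_even_to_odd:
  assumes "\<And>x y. odd8 x \<or> odd8 y \<Longrightarrow> num_walks_pm k x y = even_profile A B C x y"
    and "odd8 x \<or> odd8 y"
  shows "num_walks_pm (Suc k) x y =
    odd_profile (28 * A + 20 * B + 16 * C) (20 * A + 28 * B + 16 * C) (16 * A + 16 * B + 32 * C) x"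
proof -
  have "num_walks_pm k (a * x - y) x = even_profile A B C (a * x - y) x" for a
    using assms odd8_step by blast
  then show ?thesis
    using sum_even_profile assms(2) by (simp only: num_walks_pm_Suc)
qed

text \<open>One step ends in \<open>(a * x - y, x)\<close>, so \<open>x\<close> must be 1 or -1, and
  then exactly one \<open>a\<close> makes the first entry 0.\<close>

lemma num_walks_pm_1:
  "\<forall>x y. odd8 x \<or> odd8 y \<longrightarrow> num_walks_pm (Suc 0) x y = odd_profile 1 0 0 x"
  unfolding all_8 num_walks_pm_Suc sum_8
  by (simp add: num_walks_pm_def num_walks_0 odd_profile_def odd8_def)

text \<open>The two-step recursion has eigenvalues 64 and 16 on \<open>(A + B, C)\<close> and 8 on \<open>A - B\<close>.\<close>

lemma num_walks_pm_odd:
  "\<exists>A B C. (\<forall>x y. odd8 x \<or> odd8 y \<longrightarrow> num_walks_pm (2 * m + 1) x y = odd_profile A B C x)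
     \<and> 3 * (A + B) = 2 * 64 ^ m + 16 ^ m \<and> 3 * C + 16 ^ m = 64 ^ m \<and> A = B + 8 ^ m"
proof (induction m)
  case 0
  have "(\<forall>x y. odd8 x \<or> odd8 y \<longrightarrow> num_walks_pm (2 * 0 + 1) x y = odd_profile 1 0 0 x)
     \<and> 3 * (1 + 0) = 2 * 64 ^ 0 + (16 ^ 0 :: nat) \<and> 3 * 0 + 16 ^ 0 = (64 ^ 0 :: nat)
     \<and> 1 = 0 + (8 ^ 0 :: nat)"
    using num_walks_pm_1 by simp
  then show ?case by blast
next
  case (Suc m)
  then obtain A B C where
    profile: "\<And>x y. odd8 x \<or> odd8 y \<Longrightarrow> num_walks_pm (2 * m + 1) x y = odd_profile A B C x"
    and eqs: "3 * (A + B) = 2 * 64 ^ m + 16 ^ m" "3 * C + 16 ^ m = 64 ^ m" "A = B + 8 ^ m"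
    by blast
  define A' B' C' where "A' = 28 * A + 20 * B + 16 * C" and "B' = 20 * A + 28 * B + 16 * C"
    and "C' = 16 * A + 16 * B + 32 * C"
  have "num_walks_pm (Suc (Suc (2 * m + 1))) x y = odd_profile A' B' C' x"
    if "odd8 x \<or> odd8 y" for x y
    using num_walks_pm_even_to_odd[OF num_walks_pm_odd_to_even[OF profile] that]
    by (simp only: A'_def B'_def C'_def)
  \<comment> \<open>Here A' + B' = 48(A + B) + 32C, C' = 16(A + B) + 32C and A' - B' = 8(A - B). The
    equations are stated additively to avoid truncated subtraction.\<close>
  moreover have "3 * (A' + B') = 2 * 64 ^ Suc m + 16 ^ Suc m \<and> 3 * C' + 16 ^ Suc m = 64 ^ Suc m
      \<and> A' = B' + 8 ^ Suc m"
    using eqs unfolding A'_def B'_def C'_def power_Suc by auto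
  moreover have "2 * Suc m + 1 = Suc (Suc (2 * m + 1))" by simp
  ultimately show ?case by metis
qed

section \<open>Closed forms\<close>

lemma w8_even: "real (w8 (2 * m + 2)) = (2 * 64 ^ m + 16 ^ m) / 6 + 8 ^ m / 2"
  and w8_odd: "real (w8 (2 * m + 3)) = (8 * 64 ^ m - 2 * 16 ^ m) / 3"
proof -
  obtain A B C where
    profile: "\<And>x y. odd8 x \<or> odd8 y \<Longrightarrow> num_walks_pm (2 * m + 1) x y = odd_profile A B C x"
    and eqs: "3 * (A + B) = 2 * 64 ^ m + 16 ^ m" "3 * C + 16 ^ m = 64 ^ m" "A = B + 8 ^ m"
    using num_walks_pm_odd[of m] by blast
  have real_eqs: "3 * (real A + real B) = 2 * 64 ^ m + 16 ^ m" "3 * real C + 16 ^ m = 64 ^ m"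
    "real A = real B + 8 ^ m"
    using eqs[THEN arg_cong[where f = real]] by simp_all
  \<comment> \<open>The walks start at (1, 0), which lies in class A; A is half of (A + B) + (A -
    B).\<close>
  have "w8 (Suc (2 * m + 1)) = A"
    unfolding w8_Suc using profile[of 1 0] by (simp add: odd8_def odd_profile_def)
  then show "real (w8 (2 * m + 2)) = (2 * 64 ^ m + 16 ^ m) / 6 + 8 ^ m / 2"
    using real_eqs by (simp add: field_simps)
  have "w8 (Suc (Suc (2 * m + 1))) = 2 * A + 2 * B + 4 * C"
    unfolding w8_Suc using num_walks_pm_odd_to_even[OF profile, of 1 0]
    by (simp add: odd8_def even_profile_def)
  moreover have "2 * m + 3 = Suc (Suc (2 * m + 1))" by simp
  ultimately have "w8 (2 * m + 3) = 2 * A + 2 * B + 4 * C" by metis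
  then show "real (w8 (2 * m + 3)) = (8 * 64 ^ m - 2 * 16 ^ m) / 3"
    using real_eqs by simp
qed

theorem theorem1p5:
  fixes n :: nat
  assumes "n \<ge> 2"
  shows "w8_plus (2 * n + 1) = w8_minus (2 * n + 1)
    \<and> real (w8_minus (2 * n + 1)) = 2 ^ (6 * n - 2 * n - 7) * (2 ^ (2 * n + 3) - 8) / 3
    \<and> real (w8 (2 * n)) = 28 * 8 ^ (n - 2)
        + (2 ^ (4 * n - 5) - 2 ^ (3 * n - 3) + 2 ^ (6 * n - 6) - 2 ^ (3 * n)) / 3"
proof -
  \<comment> \<open>Shifting by 2 removes every truncated subtraction from the exponents.\<close>
  obtain j where n: "n = j + 2" using assms by (metis add.commute le_Suc_ex)
  have exps: "6 * n - 2 * n - 7 = 4 * j + 1" "2 * n + 3 = 2 * j + 7" "4 * n - 5 = 4 * j + 3"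
    "3 * n - 3 = 3 * j + 3" "6 * n - 6 = 6 * j + 6" "3 * n = 3 * j + 6" "n - 2 = j"
    "2 * n + 1 = 2 * (j + 1) + 3" "2 * n = 2 * (j + 1) + 2"
    by (simp_all add: n)
  have powers: "(2 :: real) ^ (2 * j) = 4 ^ j" "(2 :: real) ^ (3 * j) = 8 ^ j"
    "(2 :: real) ^ (4 * j) = 16 ^ j" "(2 :: real) ^ (6 * j) = 64 ^ j"
    by (simp_all add: power_mult)
  have power_64: "(64 :: real) ^ j = 16 ^ j * 4 ^ j"
    by (simp flip: power_mult_distrib)
  have sym: "w8_plus (2 * n + 1) = w8_minus (2 * n + 1)"
    by (rule w8_plus_eq_w8_minus) simp
  then have "2 * real (w8_minus (2 * n + 1)) = real (w8 (2 * n + 1))"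
    by (simp add: w8_def)
  also have "\<dots> = (8 * 64 ^ (j + 1) - 2 * 16 ^ (j + 1)) / 3"
    unfolding exps(8) by (rule w8_odd)
  finally have "real (w8_minus (2 * n + 1)) = 2 ^ (6 * n - 2 * n - 7) * (2 ^ (2 * n + 3) - 8) / 3"
    unfolding exps(1,2) power_add powers power_64 by (simp add: field_simps)
  moreover have "real (w8 (2 * n)) = 28 * 8 ^ (n - 2)
        + (2 ^ (4 * n - 5) - 2 ^ (3 * n - 3) + 2 ^ (6 * n - 6) - 2 ^ (3 * n)) / 3"
    \<comment> \<open>\<open>exps(6)\<close> comes later because it would also rewrite inside
      \<open>3 * n - 3\<close>.\<close>
    unfolding exps(3-5,7) unfolding exps(6,9) w8_even power_add powers by (simp add: field_simps)
  ultimately show ?thesis using sym by blast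
qed

end
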